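(* Let $0\le C<\infty$ and let $f=h+\overline{g}\in\mathcal{H}(C)$, where $$h(z)=\sum_{n=1}^{\infty}a_nz^n,\qquad g(z)=\sum_{n=2}^{\infty}b_nz^n\qquad (z\in\mathbb{D}).$$ Let $r_0=(\sqrt5-1)/2\approx 0.618$ and $$Q(r_0)=\left\{\frac{1+r_0}{r_0^2(1-r_0)}\,C\right\}^{1/2}\approx 3.330\sqrt{C}.$$ Then $|a_1|\le\sqrt{2C}$, and for every $n\ge2$, $$|a_n|+|b_n|\le\frac{4Q(r_0)}{\pi r_0^{n-1}}\left(1+\frac1{n-1}\right)^{n-1}<\frac{4Q(r_0)\,\mathrm{e}}{\pi r_0^{n-1}},$$ where $\mathrm{e}=\lim_{n\to\infty}(1+1/n)^n$. In the special case $C=1/2$ the estimate of $|a_1|$ is sharp, with extremal function $f(z)=z+\overline{z}^{2}/2$ (that is, this $f$ belongs to $\mathcal{H}(1/2)$ and satisfies $|a_1|=\sqrt{2C}=1$).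
   Context: $\mathbb{D}$ is the open unit disk in $\mathbb{C}$ and $\mathbb{D}_r=\{z:|z|<r\}$. A complex-valued function $f$ in $\mathbb{D}$ is a harmonic mapping if its real and imaginary parts are harmonic; then $f=h+\overline{g}$ with $h,g$ analytic, $f_z=h'$, $f_{\overline z}=\overline{g'}$, and its Jacobian is $J_f=|h'|^2-|g'|^2$. "Sense-preserving" means (locally univalent and) $|g'(z)|<|h'(z)|$ for all $z\in\mathbb{D}$. $\mathcal{H}$ denotes the set of all sense-preserving harmonic mappings $f=h+\overline{g}$ in $\mathbb{D}$ ($h,g$ analytic in $\mathbb{D}$) with $h(0)=g(0)=f_{\overline z}(0)=0$. The harmonic area function of $f$ is $S_f(r)=\int_{\mathbb{D}_r}J_f(z)\,dA(z)$, $0\le r<1$, where $dA$ is the normalized area measure on $\mathbb{D}$ (so $A(\mathbb{D})=1$). $\mathcal{H}(C)$ is the class of all $f\in\mathcal{H}$ with $C=\sup_{0<r<1}S_f(r)<\infty$. *)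

theory Defs
  imports "HOL-Complex_Analysis.Complex_Analysis"
begin

abbreviation unit_disk :: "complex set" where
  "unit_disk \<equiv> ball 0 1"

(* u is C^2 on S with vanishing Laplacian: G is the gradient of u, H z the Hessian of u at z
   (as a linear map), and the Laplacian is the trace of the Hessian. *)
definition harmonic_fun_on :: "('a::euclidean_space \<Rightarrow> real) \<Rightarrow> 'a set \<Rightarrow> bool" where
  "harmonic_fun_on u S \<longleftrightarrow>
     (\<exists>(G :: 'a \<Rightarrow> 'a) (H :: 'a \<Rightarrow> 'a \<Rightarrow> 'a).
        (\<forall>z\<in>S. (u has_derivative (\<lambda>v. G z \<bullet> v)) (at z)) \<and>
        (\<forall>z\<in>S. (G has_derivative H z) (at z)) \<and>
        (\<forall>v. continuous_on S (\<lambda>z. H z v)) \<and>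
        (\<forall>z\<in>S. (\<Sum>b\<in>Basis. H z b \<bullet> b) = 0))"

definition harmonic_mapping :: "(complex \<Rightarrow> complex) \<Rightarrow> bool" where
  "harmonic_mapping f \<longleftrightarrow>
     harmonic_fun_on (\<lambda>z. Re (f z)) unit_disk \<and> harmonic_fun_on (\<lambda>z. Im (f z)) unit_disk"

(* Wirtinger derivatives (f_x - i f_y) / 2 and (f_x + i f_y) / 2 *)
definition wirtinger_z :: "(complex \<Rightarrow> complex) \<Rightarrow> complex \<Rightarrow> complex" where
  "wirtinger_z f z =
     (frechet_derivative f (at z) 1 - \<i> * frechet_derivative f (at z) \<i>) / 2"

definition wirtinger_zbar :: "(complex \<Rightarrow> complex) \<Rightarrow> complex \<Rightarrow> complex" where
  "wirtinger_zbar f z =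
     (frechet_derivative f (at z) 1 + \<i> * frechet_derivative f (at z) \<i>) / 2"

definition canonical_rep ::
    "(complex \<Rightarrow> complex) \<Rightarrow> (complex \<Rightarrow> complex) \<Rightarrow> (complex \<Rightarrow> complex) \<Rightarrow> bool" where
  "canonical_rep f h g \<longleftrightarrow>
     h holomorphic_on unit_disk \<and> g holomorphic_on unit_disk \<and> h 0 = 0 \<and> g 0 = 0 \<and>
     (\<forall>z\<in>unit_disk. f z = h z + cnj (g z))"

lemma canonical_rep_has_derivative:
  assumes "canonical_rep f h g" and "z \<in> unit_disk"
  shows "(f has_derivative (\<lambda>v. deriv h z * v + cnj (deriv g z * v))) (at z)"
proof -
  have "(h has_field_derivative deriv h z) (at z)" "(g has_field_derivative deriv g z) (at z)"
    using assms holomorphic_derivI[OF _ open_ball] unfolding canonical_rep_def by blast+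
  then have "(h has_derivative (\<lambda>v. deriv h z * v)) (at z)"
    and g: "(g has_derivative (\<lambda>v. deriv g z * v)) (at z)"
    by (simp_all add: has_field_derivative_def)
  then have "((\<lambda>w. h w + cnj (g w)) has_derivative
      (\<lambda>v. deriv h z * v + cnj (deriv g z * v))) (at z)"
    by (intro has_derivative_add has_derivative_cnj)
  then show ?thesis
    by (rule has_derivative_transform_within_open[OF _ open_ball assms(2)])
       (use assms(1) in \<open>auto simp: canonical_rep_def\<close>)
qed

lemma
  assumes "canonical_rep f h g" and "z \<in> unit_disk"
  shows wirtinger_z_canonical_rep: "wirtinger_z f z = deriv h z"
    and wirtinger_zbar_canonical_rep: "wirtinger_zbar f z = cnj (deriv g z)"
  unfolding wirtinger_z_def wirtinger_zbar_def
    frechet_derivative_at[OF canonical_rep_has_derivative[OF assms], symmetric]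
  by (simp_all add: algebra_simps)

definition harmonic_jacobian :: "(complex \<Rightarrow> complex) \<Rightarrow> complex \<Rightarrow> real" where
  "harmonic_jacobian f z = (norm (wirtinger_z f z))\<^sup>2 - (norm (wirtinger_zbar f z))\<^sup>2"

definition sense_preserving :: "(complex \<Rightarrow> complex) \<Rightarrow> bool" where
  "sense_preserving f \<longleftrightarrow>
     (\<forall>z\<in>unit_disk. \<exists>e>0. inj_on f (ball z e \<inter> unit_disk)) \<and>
     (\<forall>z\<in>unit_disk. norm (wirtinger_zbar f z) < norm (wirtinger_z f z))"

(* The values of f outside the unit disk are irrelevant throughout. *)
definition harmonic_class :: "(complex \<Rightarrow> complex) set" where
  "harmonic_class =
     {f. harmonic_mapping f \<and> sense_preserving f \<and> (\<exists>h g. canonical_rep f h g) \<and>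
         wirtinger_zbar f 0 = 0}"

(* Division by pi normalizes the area measure, so that the unit disk has area 1. *)
definition harmonic_area :: "(complex \<Rightarrow> complex) \<Rightarrow> real \<Rightarrow> real" where
  "harmonic_area f r = (LINT z:ball 0 r|lebesgue. harmonic_jacobian f z) / pi"

definition harmonic_area_class :: "real \<Rightarrow> (complex \<Rightarrow> complex) set" where
  "harmonic_area_class C =
     {f \<in> harmonic_class. bdd_above (harmonic_area f ` {0<..<1}) \<and>
        C = (SUP r\<in>{0<..<1}. harmonic_area f r)}"

(* Only a 1, a 2, ... and b 2, b 3, ... are constrained. *)
definition power_series_coeffs ::
    "(complex \<Rightarrow> complex) \<Rightarrow> (complex \<Rightarrow> complex) \<Rightarrow> (nat \<Rightarrow> complex) \<Rightarrow> (nat \<Rightarrow> complex) \<Rightarrow> bool" where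
  "power_series_coeffs h g a b \<longleftrightarrow>
     (\<forall>z\<in>unit_disk. (\<lambda>n. a (n + 1) * z ^ (n + 1)) sums h z) \<and>
     (\<forall>z\<in>unit_disk. (\<lambda>n. b (n + 2) * z ^ (n + 2)) sums g z)"

definition r0 :: real where
  "r0 = (sqrt 5 - 1) / 2"

definition Q :: "real \<Rightarrow> real \<Rightarrow> real" where
  "Q C r = sqrt ((1 + r) / (r\<^sup>2 * (1 - r)) * C)"

end

theory Submission
  imports Defs
begin

text \<open>
  The dilatation \<open>g' / h'\<close> maps the disk into itself and vanishes at \<open>0\<close>, so by Schwarz's lemma
  \<open>|g'| \<le> |z| |h'|\<close> and the Jacobian is at least \<open>(1 - |z|\<^sup>2) |h'|\<^sup>2\<close>. Hence both \<open>h'\<close> and \<open>g'\<close> have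
  weighted mean square at most \<open>C\<close> with respect to \<open>(1 - |z|\<^sup>2) dA\<close>. Monomials are orthogonal for this
  rotation-invariant weight, so Bessel's inequality bounds each Taylor coefficient:
  \<open>n\<^sup>2 |a\<^sub>n|\<^sup>2 (1/n - 1/(n+1)) \<le> C\<close>, that is \<open>|a\<^sub>n|\<^sup>2 \<le> (n+1)/n C \<le> 2C\<close>, and likewise for \<open>b\<^sub>n\<close>.
  The stated bounds for \<open>n \<ge> 2\<close> are weaker: \<open>2 (2C)\<^sup>1\<^sup>/\<^sup>2 \<le> 2 Q(r\<^sub>0)\<close>, while the right-hand side is at
  least \<open>8 Q(r\<^sub>0) / \<pi>\<close> because \<open>(1 + 1/m)\<^sup>m \<ge> 2\<close>. Strictness of the last inequality needs \<open>C > 0\<close>,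
  which holds because \<open>a\<^sub>1 = h'(0) \<noteq> 0\<close>.
\<close>

subsection \<open>Rotation invariance of planar Lebesgue measure\<close>

text \<open>A bridge to \<open>real^2\<close>, where orthogonal maps and their effect on measure are
  available. Lebesgue measure is determined by its values on boxes, and the coordinate map pulls
  boxes back to boxes with the same side lengths.\<close>

lemma lborel_complex_eq_distr:
  "lborel = distr (lborel :: (real^2) measure) borel (\<lambda>v. Complex (v $ 1) (v $ 2))"
proof (rule lborel_eqI)
  fix l u :: complex
  assume le: "\<And>b. b \<in> Basis \<Longrightarrow> l \<bullet> b \<le> u \<bullet> b"
  have [measurable]: "(\<lambda>v::real^2. Complex (v $ 1) (v $ 2)) \<in> borel_measurable borel"
    by (intro borel_measurable_continuous_onI) (auto intro!: continuous_intros simp: Complex_eq)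
  have le': "Re l \<le> Re u" "Im l \<le> Im u"
    using le[of 1] le[of \<i>] by (auto simp: Basis_complex_def inner_complex_def)
  have B: "(Basis :: (real^2) set) = {axis 1 1, axis 2 1}"
    by (auto simp: Basis_vec_def UNIV_2)
  have "(\<lambda>v::real^2. Complex (v $ 1) (v $ 2)) -` box l u
        = box (vector [Re l, Im l]) (vector [Re u, Im u])"
    by (auto simp: box_def Basis_complex_def inner_complex_def Basis_vec_def inner_axis forall_2 vector_2)
  moreover have "(\<Prod>b\<in>Basis. (vector [Re u, Im u] - vector [Re l, Im l] :: real^2) \<bullet> b)
        = (Re u - Re l) * (Im u - Im l)"
    unfolding B by (simp add: inner_axis axis_eq_axis vector_2)
  moreover have "(\<Prod>b\<in>Basis. (u - l) \<bullet> b) = (Re u - Re l) * (Im u - Im l)"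
    by (simp add: Basis_complex_def inner_complex_def)
  ultimately show "emeasure (distr (lborel :: (real^2) measure) borel (\<lambda>v. Complex (v $ 1) (v $ 2))) (box l u)
        = (\<Prod>b\<in>Basis. (u - l) \<bullet> b)"
    using le' by (simp add: emeasure_distr emeasure_lborel_box_eq B inner_axis vector_2)
qed simp

text \<open>Testing on boxes suffices. The preimage of a box is its image under
  \<open>inv T\<close>, which is again orthogonal and therefore preserves measure.\<close>

lemma lborel_distr_orthogonal_vec:
  fixes T :: "real^'n::{finite,wellorder} \<Rightarrow> real^'n::_"
  assumes T: "orthogonal_transformation T"
  shows "distr lborel borel T = lborel"
proof (rule lborel_eqI[symmetric])
  fix l u :: "real^'n::{finite,wellorder}"
  assume le: "\<And>b. b \<in> Basis \<Longrightarrow> l \<bullet> b \<le> u \<bullet> b"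
  have "linear T" using T by (rule orthogonal_transformation_linear)
  then have [measurable]: "T \<in> borel_measurable borel"
    by (intro borel_measurable_continuous_onI linear_continuous_on) (simp add: linear_linear)
  have im: "T -` box l u = inv T ` box l u"
    using orthogonal_transformation_bij[OF T] by (rule bij_vimage_eq_inv_image)
  have inv: "orthogonal_transformation (inv T)"
    using T by (rule orthogonal_transformation_inv)
  have "emeasure lborel (T -` box l u) = emeasure lebesgue (T -` box l u)"
    using measurable_sets[of T borel borel "box l u"] by simp
  also have "\<dots> = ennreal (measure lebesgue (T -` box l u))"
    unfolding im by (intro emeasure_eq_measure2 measurable_orthogonal_image inv) auto
  also have "\<dots> = ennreal (measure lborel (box l u))"
    unfolding im by (subst measure_orthogonal_image[OF inv]) auto
  also have "\<dots> = (\<Prod>b\<in>Basis. (u - l) \<bullet> b)"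
    using le by simp
  finally show "emeasure (distr lborel borel T) (box l u) = (\<Prod>b\<in>Basis. (u - l) \<bullet> b)"
    by (simp add: emeasure_distr)
qed simp

text \<open>In the coordinates \<open>P\<close>, multiplication by a unimodular \<open>u\<close>
  becomes a linear isometry \<open>T\<close> of the plane, so the previous two lemmas combine
  through \<open>P\<close>.\<close>

lemma lborel_distr_rotation:
  fixes u :: complex
  assumes u: "norm u = 1"
  shows "distr lborel borel ((*) u) = lborel"
proof -
  define P where "P = (\<lambda>v::real^2. Complex (v $ 1) (v $ 2))"
  define T :: "real^2 \<Rightarrow> real^2" where "T = (\<lambda>v. vector [Re (u * P v), Im (u * P v)])"
  have [measurable]: "P \<in> borel_measurable borel"
    unfolding P_def
    by (intro borel_measurable_continuous_onI) (auto intro!: continuous_intros simp: Complex_eq)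
  have nP: "norm (T v) = norm v" for v
  proof -
    have "norm (T v) = norm (u * P v)"
      by (simp add: norm_vec_def L2_set_def sum_2 T_def cmod_def)
    also have "\<dots> = norm v"
      by (simp only: norm_mult u) (simp add: norm_vec_def L2_set_def sum_2 P_def cmod_def)
    finally show ?thesis .
  qed
  have "linear T"
    by (rule linearI) (auto simp: T_def P_def vec_eq_iff forall_2 vector_2 algebra_simps)
  then have T: "orthogonal_transformation T"
    using nP by (simp add: orthogonal_transformation)
  have [measurable]: "T \<in> borel_measurable borel"
    using \<open>linear T\<close>
    by (intro borel_measurable_continuous_onI linear_continuous_on) (simp add: linear_linear)
  have comp: "(*) u \<circ> P = P \<circ> T"
    by (auto simp: fun_eq_iff T_def P_def vector_2 complex_eq_iff)
  have "distr (lborel :: complex measure) borel ((*) u) = distr (distr lborel borel P) borel ((*) u)"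
    using lborel_complex_eq_distr by (simp add: P_def)
  also have "\<dots> = distr lborel borel (P \<circ> T)"
    by (simp add: distr_distr comp)
  also have "\<dots> = distr (distr lborel borel T) borel P"
    by (simp add: distr_distr)
  also have "\<dots> = lborel"
    using lborel_complex_eq_distr by (simp add: P_def lborel_distr_orthogonal_vec[OF T])
  finally show ?thesis .
qed

lemma integral_rotation:
  fixes F :: "complex \<Rightarrow> 'b::{banach, second_countable_topology}"
  assumes "norm u = 1" "F \<in> borel_measurable borel"
  shows "(LINT z|lborel. F (u * z)) = (LINT z|lborel. F z)"
proof -
  have "(LINT z|lborel. F z) = (LINT z|distr lborel borel ((*) u). F z)"
    by (simp add: lborel_distr_rotation assms(1))
  also have "\<dots> = (LINT z|lborel. F (u * z))"
    using assms(2) by (intro integral_distr) auto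
  finally show ?thesis ..
qed

subsection \<open>Moments of the disk\<close>

lemma integrable_indicator_ball:
  fixes F :: "complex \<Rightarrow> 'b::{banach, second_countable_topology}"
  assumes "continuous_on (cball 0 r) F"
  shows "integrable lborel (\<lambda>z. indicator (ball 0 r) z *\<^sub>R F z)"
proof -
  have "set_integrable lborel (cball 0 r) F"
    unfolding set_integrable_def by (intro borel_integrable_compact assms) auto
  then have "set_integrable lborel (ball 0 r) F"
    by (rule set_integrable_subset) auto
  then show ?thesis by (simp add: set_integrable_def)
qed

text \<open>\<open>harmonic_area\<close> integrates over \<open>lebesgue\<close>, whereas all
  computations below run over \<open>lborel\<close>; for Borel integrands the completion changes
  nothing.\<close>

lemma integral_indicator_ball_lebesgue:
  fixes F :: "complex \<Rightarrow> real"
  assumes "continuous_on (cball 0 r) F"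
  shows "(LINT z:ball 0 r|lebesgue. F z) = (LINT z|lborel. indicator (ball 0 r) z * F z)"
proof -
  have "(\<lambda>z. indicator (ball 0 r) z *\<^sub>R F z) \<in> borel_measurable lborel"
    using integrable_indicator_ball[OF assms] by (rule borel_measurable_integrable)
  then show ?thesis
    unfolding set_lebesgue_integral_def by (simp add: integral_completion)
qed

lemma measure_complex_ball: "0 \<le> r \<Longrightarrow> measure lborel (ball (0::complex) r) = pi * r\<^sup>2"
  using content_ball[of r "0::complex"] by (simp add: unit_ball_vol_2)

text \<open>In place of polar coordinates, the moment is differentiated as a function of the squared
  radius: a thin annulus gives the derivative \<open>pi * t ^ k\<close>, and integrating from
  \<open>0\<close> gives the formula.\<close>

lemma disk_moment:
  assumes "0 \<le> r"
  shows "(LINT z|lborel. indicator (ball 0 r) z * norm (z::complex) ^ (2 * k)) = pi * r ^ (2 * k + 2) / real (k + 1)"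
proof -
  \<comment> \<open>The squared radius \<open>t\<close> is the parameter because the disk of radius
    \<open>sqrt t\<close> has area \<open>pi * t\<close>, linear in \<open>t\<close>.\<close>
  define N :: "real \<Rightarrow> real"
    where "N = (\<lambda>t. LINT z|lborel. indicator (ball 0 (sqrt t)) z * norm (z::complex) ^ (2 * k))"
  have int: "integrable lborel (\<lambda>z::complex. indicator (ball 0 \<rho>) z * norm z ^ (2 * k))" for \<rho>
    using integrable_indicator_ball[of \<rho> "\<lambda>z. norm z ^ (2 * k)"] by (simp add: continuous_intros)
  have intm: "integrable lborel (\<lambda>z::complex. indicator (ball 0 \<rho>) z * m)" for \<rho> m :: real
    using integrable_indicator_ball[of \<rho> "\<lambda>z. m"] by simp
  have I: "(LINT z|lborel. indicator (ball 0 (sqrt t)) (z::complex) * m) = pi * t * m" if "0 \<le> t" for t m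
    using that by (simp add: measure_complex_ball)
  \<comment> \<open>On the annulus between radii \<open>sqrt s\<close> and \<open>sqrt t\<close>, of
    area \<open>pi * (t - s)\<close>, the integrand lies between \<open>s ^ k\<close> and
    \<open>t ^ k\<close>.\<close>
  have step: "pi * (t - s) * s ^ k \<le> N t - N s \<and> N t - N s \<le> pi * (t - s) * t ^ k"
    if st: "0 \<le> s" "s \<le> t" for s t
  proof -
    have mono: "sqrt s \<le> sqrt t" using st by simp
    have pw: "(norm z) ^ (2 * k) = ((norm z)\<^sup>2) ^ k" for z :: complex by (simp add: power_mult)
    have sq: "norm z < sqrt x \<longleftrightarrow> (norm z)\<^sup>2 < x" for z :: complex and x
      by (metis abs_norm_cancel real_sqrt_abs real_sqrt_less_iff)
    have "(LINT z|lborel. indicator (ball 0 (sqrt t)) (z::complex) * s ^ k - indicator (ball 0 (sqrt s)) z * s ^ k)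
          \<le> (LINT z|lborel. indicator (ball 0 (sqrt t)) (z::complex) * norm z ^ (2 * k) - indicator (ball 0 (sqrt s)) z * norm z ^ (2 * k))"
      using st by (intro integral_mono Bochner_Integration.integrable_diff int intm)
         (auto simp: indicator_def sq pw intro!: power_mono)
    moreover have "(LINT z|lborel. indicator (ball 0 (sqrt t)) (z::complex) * norm z ^ (2 * k) - indicator (ball 0 (sqrt s)) z * norm z ^ (2 * k))
       \<le> (LINT z|lborel. indicator (ball 0 (sqrt t)) (z::complex) * t ^ k - indicator (ball 0 (sqrt s)) z * t ^ k)"
      using st by (intro integral_mono Bochner_Integration.integrable_diff int intm)
         (auto simp: indicator_def sq pw intro!: power_mono)
    ultimately show ?thesis
      unfolding Bochner_Integration.integral_diff[OF int int] Bochner_Integration.integral_diff[OF intm intm]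
        I[OF st(1)] I[OF order_trans[OF st]] N_def
      by (simp add: algebra_simps)
  qed
  have D: "(N has_real_derivative pi * t ^ k) (at t within {0..})" if t: "t \<in> {0..}" for t
  proof -
    \<comment> \<open>By \<open>step\<close>, the difference quotient lies between
      \<open>pi * s ^ k\<close> and \<open>pi * t ^ k\<close>, on whichever side of \<open>t\<close>
      the point \<open>s\<close> falls.\<close>
    have "((\<lambda>s. (N s - N t) / (s - t) - pi * t ^ k) \<longlongrightarrow> 0) (at t within {0..})"
    proof (rule Lim_null_comparison)
      show "\<forall>\<^sub>F s in at t within {0..}. norm ((N s - N t) / (s - t) - pi * t ^ k) \<le> pi * \<bar>s ^ k - t ^ k\<bar>"
        unfolding eventually_at_filter
      proof (intro always_eventually allI impI)
        fix s :: real assume s: "s \<noteq> t" "s \<in> {0..}"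
        show "norm ((N s - N t) / (s - t) - pi * t ^ k) \<le> pi * \<bar>s ^ k - t ^ k\<bar>"
        proof (cases "s < t")
          case True
          with s t have st: "pi * s ^ k \<le> (N t - N s) / (t - s)" "(N t - N s) / (t - s) \<le> pi * t ^ k"
            using step[of s t] by (simp_all add: field_simps)
          moreover have "(N s - N t) / (s - t) = (N t - N s) / (t - s)"
            using True by (simp add: field_simps)
          ultimately have "\<bar>(N s - N t) / (s - t) - pi * t ^ k\<bar> \<le> \<bar>pi * (s ^ k - t ^ k)\<bar>"
            unfolding right_diff_distrib by linarith
          then show ?thesis by (simp add: abs_mult)
        next
          case False
          with s t have st: "pi * t ^ k \<le> (N s - N t) / (s - t)" "(N s - N t) / (s - t) \<le> pi * s ^ k"
            using step[of t s] by (simp_all add: field_simps)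
          then have "\<bar>(N s - N t) / (s - t) - pi * t ^ k\<bar> \<le> \<bar>pi * (s ^ k - t ^ k)\<bar>"
            unfolding right_diff_distrib by linarith
          then show ?thesis by (simp add: abs_mult)
        qed
      qed
      show "((\<lambda>s. pi * \<bar>s ^ k - t ^ k\<bar>) \<longlongrightarrow> 0) (at t within {0..})"
        by (rule tendsto_eq_intros refl | simp)+
    qed
    then show ?thesis
      unfolding has_field_derivative_iff by (simp add: LIM_zero_iff)
  qed
  have "((\<lambda>t. N t - pi * t ^ (k + 1) / real (k + 1)) has_real_derivative 0) (at t within {0..})" if "t \<in> {0..}" for t
    by (rule derivative_eq_intros D that refl | simp add: field_simps del: of_nat_Suc)+
  from has_field_derivative_zero_constant[OF _ this] obtain c
    where c: "\<And>t. 0 \<le> t \<Longrightarrow> N t - pi * t ^ (k + 1) / real (k + 1) = c" by auto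
  have "N (r\<^sup>2) = N 0 + pi * (r\<^sup>2) ^ (k + 1) / real (k + 1)"
    using c[of 0] c[of "r\<^sup>2"] by simp
  moreover have "N 0 = 0" by (simp add: N_def)
  moreover have "(r\<^sup>2) ^ (k + 1) = r ^ (2 * k + 2)"
    by (simp only: power_mult[symmetric]) (simp add: algebra_simps)
  ultimately show ?thesis using assms by (simp add: N_def)
qed

text \<open>Rotating the variable by \<open>u\<close> multiplies the integrand by
  \<open>cnj u ^ k * u ^ n\<close> but leaves the integral unchanged, so the integral vanishes once
  this factor differs from 1.\<close>

lemma disk_monomials_orthogonal:
  fixes w :: "real \<Rightarrow> real"
  assumes w: "continuous_on UNIV w" and nk: "n \<noteq> k"
  shows "(LINT z|lborel. indicator (ball 0 r) z *\<^sub>R (of_real (w (norm z)) * cnj z ^ k * z ^ n)) = 0"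
    (is "?I = 0")
proof -
  define F where "F z = indicator (ball 0 r) z *\<^sub>R (of_real (w (norm z)) * cnj z ^ k * z ^ n)" for z :: complex
  \<comment> \<open>The choice \<open>u = cis (pi / (n - k))\<close> makes the factor equal to
    \<open>cis pi\<close>, that is -1.\<close>
  obtain u :: complex where u: "norm u = 1" "cnj u ^ k * u ^ n \<noteq> 1"
  proof -
    define m where "m = (real n - real k)"
    have "m \<noteq> 0" using nk by (simp add: m_def)
    have "cnj (cis (pi / m)) ^ k * cis (pi / m) ^ n = cis (m * (pi / m))"
      by (simp only: cis_cnj Complex.DeMoivre cis_mult) (simp add: m_def left_diff_distrib diff_divide_distrib)
    also have "\<dots> \<noteq> 1" using \<open>m \<noteq> 0\<close> by simp
    finally show ?thesis by (intro that[of "cis (pi / m)"]) auto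
  qed
  have m: "(\<lambda>z. of_real (w (norm z)) * cnj z ^ k * z ^ n) \<in> borel_measurable borel"
    by (intro borel_measurable_continuous_onI)
       (auto intro!: continuous_intros continuous_on_compose2[OF w])
  have "F \<in> borel_measurable borel"
    unfolding F_def by (intro borel_measurable_scaleR borel_measurable_indicator m) auto
  then have "(LINT z|lborel. F (u * z)) = (LINT z|lborel. F z)"
    using u(1) by (rule integral_rotation[rotated])
  moreover have "F (u * z) = (cnj u ^ k * u ^ n) * F z" for z
    using u(1) by (simp add: F_def norm_mult power_mult_distrib indicator_def)
  ultimately have "(cnj u ^ k * u ^ n - 1) * (LINT z|lborel. F z) = 0"
    by (simp add: left_diff_distrib)
  with u(2) show ?thesis by (simp add: F_def)
qed

subsection \<open>Weighted Bessel inequality\<close>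

text \<open>Integrating the power series term by term, orthogonality removes every term except the
  one of index \<open>k\<close>.\<close>

lemma disk_coefficient_integral:
  fixes c :: "nat \<Rightarrow> complex" and w :: "real \<Rightarrow> real"
  assumes w: "continuous_on UNIV w" and r: "0 < r" "r < 1"
    and F: "\<And>z. norm z < 1 \<Longrightarrow> (\<lambda>n. c n * z ^ n) sums F z"
  shows "(LINT z|lborel. indicator (ball 0 r) z *\<^sub>R (of_real (w (norm z)) * cnj z ^ k * F z))
    = c k * of_real (LINT z|lborel. indicator (ball 0 r) z * (w (norm (z::complex)) * norm z ^ (2 * k)))"
proof -
  define f where "f n z = (indicator (ball 0 r) z *\<^sub>R (of_real (w (norm z)) * cnj z ^ k * z ^ n)) * c n"
    for n and z :: complex
  have cw: "continuous_on A (\<lambda>z::complex. w (norm z))" for A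
    by (rule continuous_on_compose2[OF w]) (auto intro: continuous_intros)
  have int0: "integrable lborel (\<lambda>z. indicator (ball 0 r) z *\<^sub>R (of_real (w (norm z)) * cnj z ^ k * z ^ n))" for n
    by (intro integrable_indicator_ball continuous_intros cw)
  then have int: "integrable lborel (f n)" for n
    unfolding f_def by (rule integrable_mult_left[rotated])
  \<comment> \<open>\<open>B\<close> times \<open>norm (c n) * r ^ n\<close> majorizes the
    \<open>n\<close>-th term, which justifies exchanging sum and integral.\<close>
  define B where "B z = indicator (ball 0 r) z * (\<bar>w (norm z)\<bar> * norm z ^ k)" for z :: complex
  have intB: "integrable lborel B"
    using integrable_indicator_ball[of r "\<lambda>z. \<bar>w (norm z)\<bar> * norm z ^ k"]
    by (simp add: B_def[abs_def] continuous_on_mult continuous_on_power continuous_on_norm continuous_on_norm_id continuous_on_rabs cw)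
  have bound: "norm (f n z) \<le> B z * norm (c n * of_real r ^ n)" for n z
  proof (cases "z \<in> ball 0 r")
    case True
    then have "norm z ^ n \<le> r ^ n" by (intro power_mono) auto
    then have "(\<bar>w (norm z)\<bar> * norm z ^ k * norm (c n)) * norm z ^ n \<le> (\<bar>w (norm z)\<bar> * norm z ^ k * norm (c n)) * r ^ n"
      by (intro mult_left_mono) auto
    with True r show ?thesis by (simp add: f_def B_def norm_mult norm_power mult_ac)
  qed (simp add: f_def B_def)
  \<comment> \<open>Convergence at \<open>(1 + r) / 2\<close>, strictly between \<open>r\<close> and
    1, yields absolute convergence at \<open>r\<close>.\<close>
  have sm: "summable (\<lambda>n. norm (c n * of_real r ^ n))"
  proof (rule powser_insidea)
    show "summable (\<lambda>n. c n * of_real ((1 + r) / 2) ^ n)"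
      using r by (intro sums_summable[OF F]) (simp only: norm_of_real, simp)
    show "norm (of_real r :: complex) < norm (of_real ((1 + r) / 2) :: complex)"
      using r by (simp only: norm_of_real, simp)
  qed
  have "(\<lambda>n. integral\<^sup>L lborel (f n)) sums (LINT z|lborel. (\<Sum>n. f n z))"
  proof (rule sums_integral)
    have "summable (\<lambda>n. norm (f n z))" for z
      by (rule summable_comparison_test'[OF summable_mult[OF sm, of "B z"], of 0])
         (simp only: real_norm_def abs_norm_cancel bound)
    then show "AE z in lborel. summable (\<lambda>n. norm (f n z))" by simp
    have "norm (LINT z|lborel. norm (f n z)) \<le> (LINT z|lborel. B z) * norm (c n * of_real r ^ n)" for n
    proof -
      have "(LINT z|lborel. norm (f n z)) \<le> (LINT z|lborel. B z * norm (c n * of_real r ^ n))"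
        by (intro integral_mono integrable_norm int bound integrable_mult_left intB)
      then show ?thesis by (simp add: integral_nonneg_AE)
    qed
    then show "summable (\<lambda>n. LINT z|lborel. norm (f n z))"
      by (rule summable_comparison_test'[OF summable_mult[OF sm], of 0])
  qed (rule int)
  moreover have "integral\<^sup>L lborel (f n) = 0" if "n \<noteq> k" for n
    unfolding f_def integral_mult_left_zero disk_monomials_orthogonal[OF w that] by simp
  then have "(\<lambda>n. integral\<^sup>L lborel (f n)) sums integral\<^sup>L lborel (f k)"
    using sums_finite[of "{k}" "\<lambda>n. integral\<^sup>L lborel (f n)"] by simp
  ultimately have "(LINT z|lborel. (\<Sum>n. f n z)) = integral\<^sup>L lborel (f k)"
    by (rule sums_unique2)
  moreover have "(\<Sum>n. f n z) = indicator (ball 0 r) z *\<^sub>R (of_real (w (norm z)) * cnj z ^ k * F z)" for z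
  proof (cases "z \<in> ball 0 r")
    case True
    then have "(\<lambda>n. (of_real (w (norm z)) * cnj z ^ k) * (c n * z ^ n)) sums ((of_real (w (norm z)) * cnj z ^ k) * F z)"
      using r by (intro sums_mult F) simp
    with True show ?thesis by (simp add: f_def sums_iff mult_ac)
  qed (simp add: f_def)
  moreover have "integral\<^sup>L lborel (f k) = (LINT z|lborel. c k * of_real (indicator (ball 0 r) z * (w (norm (z::complex)) * norm z ^ (2 * k))))"
  proof (rule Bochner_Integration.integral_cong[OF refl])
    fix z :: complex
    have "cnj z ^ k * z ^ k = of_real (norm z ^ (2 * k))"
      by (metis complex_norm_square mult.commute of_real_power power_mult power_mult_distrib)
    then show "f k z = c k * of_real (indicator (ball 0 r) z * (w (norm z) * norm z ^ (2 * k)))"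
      by (simp add: f_def indicator_def mult_ac del: of_real_power)
  qed
  ultimately show ?thesis
    by (simp only: integral_mult_right_zero integral_complex_of_real)
qed

text \<open>Bessel for a single monomial: expand the nonnegative weighted square norm of
  \<open>F z - c k * z ^ k\<close>. With \<open>M\<close> the weighted moment, the cross term
  contributes -2 times \<open>(norm (c k))^2 * M\<close> and the last square contributes it
  once.\<close>

lemma disk_bessel_inequality:
  fixes c :: "nat \<Rightarrow> complex" and w :: "real \<Rightarrow> real"
  assumes w: "continuous_on UNIV w" "\<And>x. 0 \<le> x \<Longrightarrow> x < r \<Longrightarrow> 0 \<le> w x" and r: "0 < r" "r < 1"
    and F: "\<And>z. norm z < 1 \<Longrightarrow> (\<lambda>n. c n * z ^ n) sums F z"
    and cont: "continuous_on (cball 0 r) F"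
  shows "(norm (c k))\<^sup>2 * (LINT z|lborel. indicator (ball 0 r) z * (w (norm (z::complex)) * norm z ^ (2 * k)))
     \<le> (LINT z|lborel. indicator (ball 0 r) z * (w (norm z) * (norm (F z))\<^sup>2))"
proof -
  define M where "M = (LINT z|lborel. indicator (ball 0 r) z * (w (norm (z::complex)) * norm z ^ (2 * k)))"
  define D where "D z = indicator (ball 0 r) z *\<^sub>R (of_real (w (norm z)) * cnj z ^ k * F z)" for z :: complex
  have cw: "continuous_on A (\<lambda>z::complex. w (norm z))" for A
    by (rule continuous_on_compose2[OF w(1)]) (auto intro: continuous_intros)
  have i1: "integrable lborel (\<lambda>z::complex. indicator (ball 0 r) z * (w (norm z) * norm z ^ (2 * k)))"
    using integrable_indicator_ball[of r "\<lambda>z. w (norm z) * norm z ^ (2 * k)"]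
    by (simp add: continuous_on_mult continuous_on_power continuous_on_norm continuous_on_norm_id continuous_on_rabs cw)
  have i2: "integrable lborel (\<lambda>z. indicator (ball 0 r) z * (w (norm z) * (norm (F z))\<^sup>2))"
    using integrable_indicator_ball[of r "\<lambda>z. w (norm z) * (norm (F z))\<^sup>2"]
    by (simp add: continuous_on_mult continuous_on_power continuous_on_norm continuous_on_norm_id continuous_on_rabs cw cont)
  have i3: "integrable lborel D"
    unfolding D_def by (intro integrable_indicator_ball continuous_intros cw cont)
  have D: "(LINT z|lborel. Re (cnj (c k) * D z)) = (norm (c k))\<^sup>2 * M"
  proof -
    have "(LINT z|lborel. Re (cnj (c k) * D z)) = Re (cnj (c k) * integral\<^sup>L lborel D)"
      using i3 by simp
    also have "integral\<^sup>L lborel D = c k * of_real M"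
      unfolding D_def M_def by (rule disk_coefficient_integral[OF w(1) r F])
    also have "cnj (c k) * (c k * of_real M) = of_real ((norm (c k))\<^sup>2 * M)"
      by (metis complex_norm_square mult.assoc mult.commute of_real_mult)
    finally show ?thesis by simp
  qed
  have exp: "(norm (x - y))\<^sup>2 = (norm x)\<^sup>2 - 2 * Re (cnj y * x) + (norm y)\<^sup>2" for x y :: complex
    unfolding cmod_power2 by (simp add: power2_eq_square algebra_simps)
  have "0 \<le> (LINT z|lborel. indicator (ball 0 r) z * (w (norm z) * (norm (F z - c k * z ^ k))\<^sup>2))"
    using w(2) by (intro integral_nonneg_AE AE_I2) (auto simp: indicator_def)
  also have "\<dots> = (LINT z|lborel. indicator (ball 0 r) z * (w (norm z) * (norm (F z))\<^sup>2)
      - 2 * Re (cnj (c k) * D z)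
      + (norm (c k))\<^sup>2 * (indicator (ball 0 r) z * (w (norm z) * norm z ^ (2 * k))))"
  proof (rule Bochner_Integration.integral_cong[OF refl])
    fix z
    have "(norm (F z - c k * z ^ k))\<^sup>2 = (norm (F z))\<^sup>2 - 2 * Re (cnj (c k) * cnj z ^ k * F z) + (norm (c k * z ^ k))\<^sup>2"
      using exp[of "F z" "c k * z ^ k"] by simp
    also have "(norm (c k * z ^ k))\<^sup>2 = (norm (c k))\<^sup>2 * norm z ^ (2 * k)"
      by (simp add: norm_mult norm_power power_mult_distrib power_mult[symmetric] mult.commute)
    moreover have E: "Re (cnj (c k) * D z) = indicator (ball 0 r) z * (w (norm z) * Re (cnj (c k) * cnj z ^ k * F z))"
    proof -
      have "cnj (c k) * D z = (indicator (ball 0 r) z * w (norm z)) *\<^sub>R (cnj (c k) * cnj z ^ k * F z)"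
        by (simp add: D_def scaleR_conv_of_real mult_ac)
      then show ?thesis by (simp only: scaleR_complex.sel mult.assoc)
    qed
    ultimately show "indicator (ball 0 r) z * (w (norm z) * (norm (F z - c k * z ^ k))\<^sup>2) =
       indicator (ball 0 r) z * (w (norm z) * (norm (F z))\<^sup>2)
      - 2 * Re (cnj (c k) * D z)
      + (norm (c k))\<^sup>2 * (indicator (ball 0 r) z * (w (norm z) * norm z ^ (2 * k)))"
      unfolding E by (simp only:) (simp add: right_diff_distrib distrib_left mult_ac)
  qed
  also have "\<dots> = (LINT z|lborel. indicator (ball 0 r) z * (w (norm z) * (norm (F z))\<^sup>2))
      - 2 * ((norm (c k))\<^sup>2 * M) + (norm (c k))\<^sup>2 * M"
    using i1 i2 i3 by (simp add: D M_def del: minus_complex.simps times_complex.simps)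
  finally show ?thesis by (simp add: M_def)
qed

text \<open>For the weight \<open>1 - x^2\<close> the moment of order \<open>2 * k\<close> is a
  difference of two disk moments; as \<open>r\<close> tends to 1, after division by
  \<open>pi\<close>, it becomes \<open>1/(k+1) - 1/(k+2)\<close>, the reciprocal of the product on
  the right.\<close>

lemma disk_coefficient_bound:
  fixes c :: "nat \<Rightarrow> complex"
  assumes F: "\<And>z. norm z < 1 \<Longrightarrow> (\<lambda>n. c n * z ^ n) sums F z"
    and cont: "continuous_on (ball 0 1) F"
    and bound: "\<And>r. 0 < r \<Longrightarrow> r < 1 \<Longrightarrow>
      (LINT z|lborel. indicator (ball 0 r) z * ((1 - (norm z)\<^sup>2) * (norm (F z))\<^sup>2)) \<le> pi * C"
  shows "(norm (c k))\<^sup>2 \<le> real (k + 1) * real (k + 2) * C"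
proof -
  have le: "(norm (c k))\<^sup>2 * (r ^ (2 * k + 2) / real (k + 1) - r ^ (2 * k + 4) / real (k + 2)) \<le> C"
    if r: "0 < r" "r < 1" for r
  proof -
    have i: "integrable lborel (\<lambda>z::complex. indicator (ball 0 r) z * norm z ^ (2 * j))" for j
      using integrable_indicator_ball[of r "\<lambda>z. norm z ^ (2 * j)"] by (simp add: continuous_intros)
    have "(LINT z|lborel. indicator (ball 0 r) z * ((1 - (norm (z::complex))\<^sup>2) * norm z ^ (2 * k)))
      = (LINT z|lborel. indicator (ball 0 r) z * norm (z::complex) ^ (2 * k)
           - indicator (ball 0 r) z * norm z ^ (2 * (k + 1)))"
      by (simp add: algebra_simps power2_eq_square)
    also have "\<dots> = pi * (r ^ (2 * k + 2) / real (k + 1) - r ^ (2 * k + 4) / real (k + 2))"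
    proof -
      have "2 * (k + 1) + 2 = 2 * k + 4" "k + 1 + 1 = k + 2" by simp_all
      then show ?thesis
        using r disk_moment[of r k] disk_moment[of r "k + 1"]
        unfolding Bochner_Integration.integral_diff[OF i i] by (simp add: right_diff_distrib eval_nat_numeral del: power_Suc)
    qed
    finally have M: "(LINT z|lborel. indicator (ball 0 r) z * ((1 - (norm (z::complex))\<^sup>2) * norm z ^ (2 * k)))
      = pi * (r ^ (2 * k + 2) / real (k + 1) - r ^ (2 * k + 4) / real (k + 2))" .
    have "(norm (c k))\<^sup>2 * (pi * (r ^ (2 * k + 2) / real (k + 1) - r ^ (2 * k + 4) / real (k + 2)))
       \<le> (LINT z|lborel. indicator (ball 0 r) z * ((1 - (norm z)\<^sup>2) * (norm (F z))\<^sup>2))"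
      unfolding M[symmetric]
    proof (rule disk_bessel_inequality[where w = "\<lambda>x. 1 - x\<^sup>2"])
      show "continuous_on (cball 0 r) F"
        by (rule continuous_on_subset[OF cont]) (use r in auto)
    next
      fix x :: real assume "0 \<le> x" "x < r"
      then show "0 \<le> 1 - x\<^sup>2" using r by (simp add: power_le_one)
    qed (use r F in \<open>auto intro!: continuous_intros\<close>)
    also have "\<dots> \<le> pi * C" using bound r by blast
    finally show ?thesis by (simp add: mult.left_commute)
  qed
  \<comment> \<open>The bound on the left does not depend on \<open>r\<close>, so it survives the
    limit as \<open>r\<close> increases to 1.\<close>
  have "((\<lambda>r. (norm (c k))\<^sup>2 * (r ^ (2 * k + 2) / real (k + 1) - r ^ (2 * k + 4) / real (k + 2)))
     \<longlongrightarrow> (norm (c k))\<^sup>2 * (1 ^ (2 * k + 2) / real (k + 1) - 1 ^ (2 * k + 4) / real (k + 2))) (at_left 1)"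
    by (intro tendsto_intros) auto
  moreover have "\<forall>\<^sub>F r in at_left 1. (norm (c k))\<^sup>2 * (r ^ (2 * k + 2) / real (k + 1) - r ^ (2 * k + 4) / real (k + 2)) \<le> C"
    using eventually_at_left_real[OF zero_less_one] by eventually_elim (rule le; simp)
  ultimately have "(norm (c k))\<^sup>2 * (1 ^ (2 * k + 2) / real (k + 1) - 1 ^ (2 * k + 4) / real (k + 2)) \<le> C"
    by (rule tendsto_upperbound) simp
  moreover have "1 ^ (2 * k + 2) / real (k + 1) - 1 ^ (2 * k + 4) / real (k + 2) = 1 / (real (k + 1) * real (k + 2))"
    by (simp add: field_simps)
  ultimately have "(norm (c k))\<^sup>2 / (real (k + 1) * real (k + 2)) \<le> C" by simp
  then show ?thesis by (subst (asm) pos_divide_le_eq) (simp_all add: mult_ac)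
qed

subsection \<open>Coefficient bounds\<close>

lemma harmonic_jacobian_canonical_rep:
  assumes "canonical_rep f h g" "z \<in> unit_disk"
  shows "harmonic_jacobian f z = (norm (deriv h z))\<^sup>2 - (norm (deriv g z))\<^sup>2"
  using assms by (simp add: harmonic_jacobian_def wirtinger_z_canonical_rep wirtinger_zbar_canonical_rep)

lemma harmonic_area_canonical_rep:
  assumes "canonical_rep f h g" "r < 1"
  shows "harmonic_area f r
    = (LINT z|lborel. indicator (ball 0 r) z * ((norm (deriv h z))\<^sup>2 - (norm (deriv g z))\<^sup>2)) / pi"
proof -
  have hol: "deriv h holomorphic_on unit_disk" "deriv g holomorphic_on unit_disk"
    using assms by (auto simp: canonical_rep_def intro!: holomorphic_deriv)
  have "(LINT z:ball 0 r|lebesgue. harmonic_jacobian f z)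
    = (LINT z:ball 0 r|lebesgue. (norm (deriv h z))\<^sup>2 - (norm (deriv g z))\<^sup>2)"
    using assms by (intro set_lebesgue_integral_cong) (auto intro!: harmonic_jacobian_canonical_rep)
  also have "\<dots> = (LINT z|lborel. indicator (ball 0 r) z * ((norm (deriv h z))\<^sup>2 - (norm (deriv g z))\<^sup>2))"
    using assms(2)
    by (intro integral_indicator_ball_lebesgue continuous_intros
        continuous_on_subset[OF holomorphic_on_imp_continuous_on[OF hol(1)]]
        continuous_on_subset[OF holomorphic_on_imp_continuous_on[OF hol(2)]]) auto
  finally show ?thesis by (simp add: harmonic_area_def)
qed

lemma norm_deriv_less_of_sense_preserving:
  assumes "sense_preserving f" "canonical_rep f h g" "z \<in> unit_disk"
  shows "norm (deriv g z) < norm (deriv h z)"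
proof -
  have "norm (wirtinger_zbar f z) < norm (wirtinger_z f z)"
    using assms(1,3) unfolding sense_preserving_def by blast
  then show ?thesis
    by (simp add: wirtinger_z_canonical_rep[OF assms(2,3)] wirtinger_zbar_canonical_rep[OF assms(2,3)])
qed

text \<open>Schwarz's lemma for the dilatation: sense preservation keeps the denominator nonzero and
  the quotient inside the disk, and the normalization of \<open>wirtinger_zbar f 0\<close> makes it
  vanish at the origin.\<close>

lemma norm_deriv_le_of_harmonic_class:
  assumes f: "f \<in> harmonic_class" and rep: "canonical_rep f h g" and z: "z \<in> unit_disk"
  shows "norm (deriv g z) \<le> norm z * norm (deriv h z)"
proof -
  have lt: "norm (deriv g x) < norm (deriv h x)" if "x \<in> unit_disk" for x
    using f norm_deriv_less_of_sense_preserving[OF _ rep that] by (simp add: harmonic_class_def)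
  have nz: "deriv h x \<noteq> 0" if "x \<in> unit_disk" for x
    using lt[OF that] by auto
  have g0: "deriv g 0 = 0"
    using f wirtinger_zbar_canonical_rep[OF rep, of 0] by (simp add: harmonic_class_def)
  define \<omega> where "\<omega> = (\<lambda>x. deriv g x / deriv h x)"
  have "norm (\<omega> z) \<le> norm z"
  proof (rule Schwarz_Lemma(1))
    show "\<omega> holomorphic_on ball 0 1"
      unfolding \<omega>_def using rep nz
      by (intro holomorphic_on_divide holomorphic_deriv) (auto simp: canonical_rep_def)
    show "\<omega> 0 = 0" by (simp add: \<omega>_def g0)
    show "norm (\<omega> x) < 1" if "norm x < 1" for x
    proof -
      have "x \<in> unit_disk" using that by simp
      then show ?thesis using lt nz by (simp add: \<omega>_def norm_divide)
    qed
  qed (use z in simp)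
  then show ?thesis using nz[OF z] by (simp add: \<omega>_def norm_divide field_simps)
qed

text \<open>The first integrand is dominated pointwise by the Jacobian, whose integral is at most
  \<open>pi\<close> times the supremum \<open>C\<close>; the second is dominated by the first since
  \<open>|g'| <= |h'|\<close>.\<close>

lemma harmonic_area_class_weighted_bound:
  assumes f: "f \<in> harmonic_area_class C" and rep: "canonical_rep f h g" and r: "0 < r" "r < 1"
  shows "(LINT z|lborel. indicator (ball 0 r) z * ((1 - (norm z)\<^sup>2) * (norm (deriv h z))\<^sup>2)) \<le> pi * C"
    and "(LINT z|lborel. indicator (ball 0 r) z * ((1 - (norm z)\<^sup>2) * (norm (deriv g z))\<^sup>2)) \<le> pi * C"
proof -
  have hol: "deriv h holomorphic_on unit_disk" "deriv g holomorphic_on unit_disk"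
    using rep by (auto simp: canonical_rep_def intro!: holomorphic_deriv)
  have cont: "continuous_on (cball 0 r) (deriv h)" "continuous_on (cball 0 r) (deriv g)"
    using r by (auto intro!: continuous_on_subset[OF holomorphic_on_imp_continuous_on[OF hol(1)]]
        continuous_on_subset[OF holomorphic_on_imp_continuous_on[OF hol(2)]])
  have fc: "f \<in> harmonic_class" using f by (simp add: harmonic_area_class_def)
  have le: "norm (deriv g z) \<le> norm z * norm (deriv h z)" if "norm z < r" for z
    using norm_deriv_le_of_harmonic_class[OF fc rep] that r by simp
  have int: "integrable lborel (\<lambda>z. indicator (ball 0 r) z * G z)"
    if "continuous_on (cball 0 r) G" for G :: "complex \<Rightarrow> real"
    using integrable_indicator_ball[OF that] by simp
  have area: "harmonic_area f r \<le> C"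
    using f r by (auto simp: harmonic_area_class_def intro!: cSUP_upper)
  have "(LINT z|lborel. indicator (ball 0 r) z * ((1 - (norm z)\<^sup>2) * (norm (deriv h z))\<^sup>2))
     \<le> (LINT z|lborel. indicator (ball 0 r) z * ((norm (deriv h z))\<^sup>2 - (norm (deriv g z))\<^sup>2))"
  proof (intro integral_mono int continuous_intros cont)
    fix z
    have "(norm (deriv g z))\<^sup>2 \<le> (norm z * norm (deriv h z))\<^sup>2" if "norm z < r"
      using le[OF that] by (intro power_mono) auto
    then show "indicator (ball 0 r) z * ((1 - (norm z)\<^sup>2) * (norm (deriv h z))\<^sup>2)
      \<le> indicator (ball 0 r) z * ((norm (deriv h z))\<^sup>2 - (norm (deriv g z))\<^sup>2)"
      by (auto simp: indicator_def power_mult_distrib left_diff_distrib)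
  qed
  also have "\<dots> \<le> pi * C"
    using area r harmonic_area_canonical_rep[OF rep r(2)] by (simp add: field_simps)
  finally show h: "(LINT z|lborel. indicator (ball 0 r) z * ((1 - (norm z)\<^sup>2) * (norm (deriv h z))\<^sup>2)) \<le> pi * C" .
  have "(LINT z|lborel. indicator (ball 0 r) z * ((1 - (norm z)\<^sup>2) * (norm (deriv g z))\<^sup>2))
     \<le> (LINT z|lborel. indicator (ball 0 r) z * ((1 - (norm z)\<^sup>2) * (norm (deriv h z))\<^sup>2))"
  proof (intro integral_mono int continuous_intros cont)
    fix z
    have "(1 - (norm z)\<^sup>2) * (norm (deriv g z))\<^sup>2 \<le> (1 - (norm z)\<^sup>2) * (norm (deriv h z))\<^sup>2" if "norm z < r"
    proof (intro mult_left_mono power_mono)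
      show "norm (deriv g z) \<le> norm (deriv h z)"
        using le[OF that] mult_right_mono[of "norm z" 1 "norm (deriv h z)"] that r by simp
      show "0 \<le> 1 - (norm z)\<^sup>2" using that r by (simp add: power_le_one)
    qed auto
    then show "indicator (ball 0 r) z * ((1 - (norm z)\<^sup>2) * (norm (deriv g z))\<^sup>2)
      \<le> indicator (ball 0 r) z * ((1 - (norm z)\<^sup>2) * (norm (deriv h z))\<^sup>2)"
      by (auto simp: indicator_def)
  qed
  also note h
  finally show "(LINT z|lborel. indicator (ball 0 r) z * ((1 - (norm z)\<^sup>2) * (norm (deriv g z))\<^sup>2)) \<le> pi * C" .
qed

text \<open>The preceding estimate is applied to the derivative, whose coefficient of index
  \<open>n - 1\<close> is \<open>n * c n\<close>. Cancelling one factor \<open>n\<close> leaves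
  \<open>n * |c n|^2 <= (n + 1) * C\<close>, and \<open>n + 1 <= 2 * n\<close>.\<close>

lemma power_series_coefficient_bound:
  fixes c :: "nat \<Rightarrow> complex"
  assumes hol: "F holomorphic_on unit_disk" and F: "\<And>z. norm z < 1 \<Longrightarrow> (\<lambda>n. c n * z ^ n) sums F z"
    and bound: "\<And>r. 0 < r \<Longrightarrow> r < 1 \<Longrightarrow>
      (LINT z|lborel. indicator (ball 0 r) z * ((1 - (norm z)\<^sup>2) * (norm (deriv F z))\<^sup>2)) \<le> pi * C"
    and n: "1 \<le> n"
  shows "norm (c n) \<le> sqrt (2 * C)"
proof -
  obtain k where k: "n = Suc k" using n by (cases n) auto
  have "(\<lambda>n. diffs c n * z ^ n) sums deriv F z" if "norm z < 1" for z
    using F _ that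
    by (rule termdiffs_sums_strong) (use that in \<open>auto intro!: holomorphic_derivI[OF hol open_ball]\<close>)
  then have "(norm (diffs c k))\<^sup>2 \<le> real (k + 1) * real (k + 2) * C"
    using holomorphic_on_imp_continuous_on[OF holomorphic_deriv[OF hol open_ball]] bound
    by (rule disk_coefficient_bound)
  then have "real (k + 1) * (real (k + 1) * (norm (c n))\<^sup>2) \<le> real (k + 1) * (real (k + 2) * C)"
    by (simp add: diffs_def k norm_mult power_mult_distrib power2_eq_square mult_ac del: of_nat_Suc of_nat_add)
  then have le: "real (k + 1) * (norm (c n))\<^sup>2 \<le> real (k + 2) * C"
    by (rule mult_left_le_imp_le) simp
  \<comment> \<open>Nonnegativity of \<open>C\<close> is read off from the inequality just
    obtained.\<close>
  have "0 \<le> real (k + 2) * C" using le by (rule order_trans[rotated]) simp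
  then have "0 \<le> C" by (simp add: zero_le_mult_iff)
  then have "real (k + 2) * C \<le> real (k + 1) * (2 * C)"
    by (simp add: algebra_simps)
  with le have "real (k + 1) * (norm (c n))\<^sup>2 \<le> real (k + 1) * (2 * C)" by linarith
  then have "(norm (c n))\<^sup>2 \<le> 2 * C" by (rule mult_left_le_imp_le) simp
  then show ?thesis by (rule real_le_rsqrt)
qed

lemma sums_nat_shift:
  fixes f :: "nat \<Rightarrow> 'a::real_normed_vector"
  assumes "(\<lambda>n. f (n + k)) sums s" "\<And>n. n < k \<Longrightarrow> f n = 0"
  shows "f sums s"
  using assms by (subst (asm) sums_iff_shift) simp

lemma harmonic_area_class_coefficient_bounds:
  assumes f: "f \<in> harmonic_area_class C" and rep: "canonical_rep f h g"
    and ps: "power_series_coeffs h g a b"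
  shows "1 \<le> n \<Longrightarrow> norm (a n) \<le> sqrt (2 * C)" and "2 \<le> n \<Longrightarrow> norm (b n) \<le> sqrt (2 * C)"
    and "0 < C"
proof -
  have hol: "h holomorphic_on unit_disk" "g holomorphic_on unit_disk"
    using rep by (auto simp: canonical_rep_def)
  \<comment> \<open>\<open>power_series_coeffs\<close> leaves \<open>a 0\<close>, \<open>b 0\<close>
    and \<open>b 1\<close> arbitrary, so they are replaced by 0 to obtain genuine Taylor
    coefficients.\<close>
  define c where "c n = (if n < 1 then 0 else a n)" for n
  define d where "d n = (if n < 2 then 0 else b n)" for n
  have c: "(\<lambda>n. c n * z ^ n) sums h z" if "norm z < 1" for z
    by (rule sums_nat_shift[where k = 1]) (use ps that in \<open>auto simp: power_series_coeffs_def c_def\<close>)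
  have d: "(\<lambda>n. d n * z ^ n) sums g z" if "norm z < 1" for z
    by (rule sums_nat_shift[where k = 2]) (use ps that in \<open>auto simp: power_series_coeffs_def d_def\<close>)
  have a_le: "norm (a n) \<le> sqrt (2 * C)" if "1 \<le> n" for n
    using power_series_coefficient_bound[OF hol(1) c harmonic_area_class_weighted_bound(1)[OF f rep] that] that
    by (simp add: c_def)
  then show "norm (a n) \<le> sqrt (2 * C)" if "1 \<le> n" using that .
  show "norm (b n) \<le> sqrt (2 * C)" if "2 \<le> n"
    using power_series_coefficient_bound[OF hol(2) d harmonic_area_class_weighted_bound(2)[OF f rep], of n] that
    by (simp add: d_def)
  \<comment> \<open>The differentiated series at the origin identifies \<open>a 1\<close> with
    \<open>h'(0)\<close>, which sense preservation makes nonzero; the bound on \<open>a 1\<close>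
    then forces \<open>C\<close> to be positive.\<close>
  have "(\<lambda>n. diffs c n * 0 ^ n) sums deriv h 0"
    using c by (rule termdiffs_sums_strong) (auto intro!: holomorphic_derivI[OF hol(1) open_ball])
  then have "deriv h 0 = a 1"
    using powser_sums_zero_iff[of "diffs c" "deriv h 0"] by (simp add: diffs_def c_def)
  moreover have "norm (deriv g 0) < norm (deriv h 0)"
    using f norm_deriv_less_of_sense_preserving[OF _ rep, of 0]
    by (simp add: harmonic_area_class_def harmonic_class_def)
  ultimately have "0 < norm (a 1)"
    by auto
  with a_le[of 1] have "0 < sqrt (2 * C)" by linarith
  then show "0 < C" by simp
qed

section \<open>Numerical estimates for the constants\<close>

lemma r0_bounds: "1 / 2 < r0" "r0 < 1"
proof -
  have "2 < sqrt 5" "sqrt 5 < 3" by (rule real_less_rsqrt real_less_lsqrt; simp)+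
  then show "1 / 2 < r0" "r0 < 1" by (auto simp: r0_def)
qed

text \<open>For \<open>r0\<close> between 1/2 and 1 the denominator \<open>r0^2 * (1 - r0)\<close>
  is at most 1/2, so the factor of \<open>C\<close> under the root in \<open>Q\<close> is at least
  2.\<close>

lemma sqrt_le_Q_r0:
  assumes "0 \<le> C"
  shows "sqrt (2 * C) \<le> Q C r0"
proof -
  note r = r0_bounds
  have "r0\<^sup>2 * (1 - r0) \<le> 1 * (1 / 2)"
    using r by (intro mult_mono power_le_one) auto
  then have "2 * (r0\<^sup>2 * (1 - r0)) \<le> 1 + r0" using r by linarith
  then have "2 \<le> (1 + r0) / (r0\<^sup>2 * (1 - r0))"
    using r by (subst pos_le_divide_eq) auto
  then show ?thesis
    unfolding Q_def using assms by (intro real_sqrt_le_mono mult_right_mono)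
qed

text \<open>The lower bound is Bernoulli's inequality; the upper one is the \<open>m\<close>-th
  power of \<open>1 + x < exp x\<close> at \<open>x = 1/m\<close>.\<close>

lemma one_plus_inverse_power_bounds:
  assumes "1 \<le> m"
  shows "2 \<le> (1 + 1 / real m) ^ m" and "(1 + 1 / real m) ^ m < exp 1"
proof -
  show "2 \<le> (1 + 1 / real m) ^ m"
    using assms Bernoulli_inequality[of "1 / real m" m] order_trans[of "-1" 0 "1 / real m"] by simp
  have "1 + 1 / real m < exp (1 / real m)"
    using assms ln_add_one_self_less_self[of "1 / real m"]
    by (subst ln_less_cancel_iff[symmetric]) (simp_all add: add_pos_nonneg)
  then have "(1 + 1 / real m) ^ m < exp (1 / real m) ^ m"
    using assms by (intro power_strict_mono) auto
  also have "\<dots> = exp 1" using assms by (simp flip: exp_of_nat_mult)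
  finally show "(1 + 1 / real m) ^ m < exp 1" .
qed

subsection \<open>The extremal map\<close>

text \<open>Its dilatation is \<open>z\<close>, the equality case of the Schwarz estimate used
  above.\<close>

definition extremal_map :: "complex \<Rightarrow> complex" where
  "extremal_map z = z + (cnj z)\<^sup>2 / 2"

lemma canonical_rep_extremal_map: "canonical_rep extremal_map (\<lambda>z. z) (\<lambda>z. z\<^sup>2 / 2)"
  by (auto simp: canonical_rep_def extremal_map_def intro!: holomorphic_intros)

lemma deriv_half_square: "deriv (\<lambda>z::complex. z\<^sup>2 / 2) z = z"
  by (rule DERIV_imp_deriv) (auto intro!: derivative_eq_intros)

lemma harmonic_mapping_extremal_map: "harmonic_mapping extremal_map"
  unfolding harmonic_mapping_def
proof
  show "harmonic_fun_on (\<lambda>z. Re (extremal_map z)) unit_disk"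
    unfolding harmonic_fun_on_def
  \<comment> \<open>The real part is \<open>x + (x^2 - y^2)/2\<close>, with gradient
    \<open>(1 + x, -y)\<close>; the Hessian is conjugation, of trace 0.\<close>
  proof (intro exI[of _ "\<lambda>z. 1 + cnj z"] exI[of _ "\<lambda>z. cnj"] conjI ballI allI)
    fix z
    show "((\<lambda>z. Re (extremal_map z)) has_derivative (\<lambda>v. (1 + cnj z) \<bullet> v)) (at z)"
      unfolding extremal_map_def power2_eq_square
      by (auto intro!: derivative_eq_intros simp: fun_eq_iff inner_complex_def field_simps)
    show "((\<lambda>z. 1 + cnj z) has_derivative cnj) (at z)"
      by (auto intro!: derivative_eq_intros)
  qed (auto simp: Basis_complex_def inner_complex_def intro!: continuous_intros)
  show "harmonic_fun_on (\<lambda>z. Im (extremal_map z)) unit_disk"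
    unfolding harmonic_fun_on_def
  \<comment> \<open>The imaginary part is \<open>y - x*y\<close>, with gradient
    \<open>(-y, 1 - x)\<close>; the Hessian sends \<open>(x, y)\<close> to
    \<open>(-y, -x)\<close>.\<close>
  proof (intro exI[of _ "\<lambda>z. \<i> - \<i> * cnj z"] exI[of _ "\<lambda>z v. - \<i> * cnj v"] conjI ballI allI)
    fix z
    show "((\<lambda>z. Im (extremal_map z)) has_derivative (\<lambda>v. (\<i> - \<i> * cnj z) \<bullet> v)) (at z)"
      unfolding extremal_map_def power2_eq_square
      by (auto intro!: derivative_eq_intros simp: fun_eq_iff inner_complex_def field_simps)
    show "((\<lambda>z. \<i> - \<i> * cnj z) has_derivative (\<lambda>v. - \<i> * cnj v)) (at z)"
      by (auto intro!: derivative_eq_intros)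
  qed (auto simp: Basis_complex_def inner_complex_def intro!: continuous_intros)
qed

text \<open>Equal values make \<open>|z - w|\<close> equal to \<open>|z - w| * |z + w| / 2\<close>,
  and \<open>|z + w| < 2\<close> in the disk, so the difference is 0.\<close>

lemma inj_on_extremal_map: "inj_on extremal_map unit_disk"
proof (rule inj_onI)
  fix z w assume zw: "z \<in> unit_disk" "w \<in> unit_disk" and eq: "extremal_map z = extremal_map w"
  have "z - w = - (cnj (z - w) * (cnj (z + w) / 2))"
  proof -
    have "z - w = (cnj w)\<^sup>2 / 2 - (cnj z)\<^sup>2 / 2"
      using eq unfolding extremal_map_def by (simp add: diff_eq_eq diff_add_eq eq_diff_eq)
    then show ?thesis by (simp add: power2_eq_square field_simps)
  qed
  then have "norm (z - w) = norm (z - w) * (norm (z + w) / 2)"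
    by (metis complex_mod_cnj norm_divide norm_minus_cancel norm_mult norm_numeral)
  moreover have "norm (z + w) < 2"
    using zw norm_triangle_ineq[of z w] by simp
  ultimately show "z = w" by auto
qed

lemma extremal_map_in_harmonic_class: "extremal_map \<in> harmonic_class"
proof -
  have w: "wirtinger_z extremal_map z = 1" "wirtinger_zbar extremal_map z = cnj z" if "z \<in> unit_disk" for z
    using wirtinger_z_canonical_rep[OF canonical_rep_extremal_map that]
      wirtinger_zbar_canonical_rep[OF canonical_rep_extremal_map that]
    by (simp_all add: deriv_half_square)
  have "sense_preserving extremal_map"
    unfolding sense_preserving_def
  proof (intro conjI ballI exI)
    fix z :: complex
    show "inj_on extremal_map (ball z 1 \<inter> unit_disk)"
      by (rule inj_on_subset[OF inj_on_extremal_map]) auto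
  qed (auto simp: w)
  then show ?thesis
    using w(2)[of 0] harmonic_mapping_extremal_map canonical_rep_extremal_map
    by (auto simp: harmonic_class_def)
qed

text \<open>The Jacobian is \<open>1 - |z|^2\<close>, so the area is a difference of the disk
  moments with \<open>k = 0\<close> and \<open>k = 1\<close>.\<close>

lemma harmonic_area_extremal_map:
  assumes "0 < r" "r < 1"
  shows "harmonic_area extremal_map r = r\<^sup>2 - r ^ 4 / 2"
proof -
  have i: "integrable lborel (\<lambda>z::complex. indicator (ball 0 r) z * norm z ^ (2 * j))" for j
    using integrable_indicator_ball[of r "\<lambda>z. norm z ^ (2 * j)"] by (simp add: continuous_intros)
  have "harmonic_area extremal_map r
    = (LINT z|lborel. indicator (ball 0 r) z * norm (z::complex) ^ (2 * 0) - indicator (ball 0 r) z * norm z ^ (2 * 1)) / pi"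
    using harmonic_area_canonical_rep[OF canonical_rep_extremal_map assms(2)]
    by (simp add: deriv_half_square right_diff_distrib)
  also have "\<dots> = (pi * r\<^sup>2 - pi * r ^ 4 / 2) / pi"
    using disk_moment[of r 0] disk_moment[of r 1] assms
    unfolding Bochner_Integration.integral_diff[OF i i]
    by (simp add: power2_eq_square power4_eq_xxxx field_simps)
  also have "\<dots> = r\<^sup>2 - r ^ 4 / 2" by (simp add: field_simps)
  finally show ?thesis .
qed

lemma extremal_map_in_harmonic_area_class: "extremal_map \<in> harmonic_area_class (1 / 2)"
proof -
  have le: "harmonic_area extremal_map r \<le> 1 / 2" if "r \<in> {0<..<1}" for r
  proof -
    \<comment> \<open>Completing the square shows that the area stays below 1/2; the supremum is
      approached only as \<open>r\<close> tends to 1.\<close>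
    have "r\<^sup>2 - r ^ 4 / 2 = 1 / 2 - (1 - r\<^sup>2)\<^sup>2 / 2"
      by (simp add: power2_eq_square power4_eq_xxxx field_simps)
    then show ?thesis using that harmonic_area_extremal_map[of r] by simp
  qed
  then have bdd: "bdd_above (harmonic_area extremal_map ` {0<..<1})"
    by (intro bdd_aboveI2)
  have "1 / 2 \<le> (SUP r\<in>{0<..<1}. harmonic_area extremal_map r)"
  proof (rule tendsto_upperbound)
    show "((\<lambda>r::real. r\<^sup>2 - r ^ 4 / 2) \<longlongrightarrow> 1 / 2) (at_left 1)"
      by (auto intro!: tendsto_eq_intros)
    show "\<forall>\<^sub>F r in at_left 1. r\<^sup>2 - r ^ 4 / 2 \<le> (SUP r\<in>{0<..<1}. harmonic_area extremal_map r)"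
      using eventually_at_left_real[OF zero_less_one]
    proof eventually_elim
      case (elim r)
      then show ?case
        using cSUP_upper[OF elim bdd] harmonic_area_extremal_map[of r] by simp
    qed
  qed simp
  moreover have "(SUP r\<in>{0<..<1}. harmonic_area extremal_map r) \<le> 1 / 2"
    by (rule cSUP_least) (use le in auto)
  ultimately show ?thesis
    using bdd extremal_map_in_harmonic_class by (simp add: harmonic_area_class_def)
qed

lemma power_series_coeffs_extremal_map:
  "power_series_coeffs (\<lambda>z. z) (\<lambda>z. z\<^sup>2 / 2) (\<lambda>n. if n = 1 then 1 else 0) (\<lambda>n. if n = 2 then 1 / 2 else 0)"
  unfolding power_series_coeffs_def
proof (intro conjI ballI)
  fix z :: complex
  show "(\<lambda>n. (if n + 1 = 1 then 1 else 0) * z ^ (n + 1)) sums z"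
    \<comment> \<open>After the index shift, the coefficient of \<open>z\<close> sits at index
      0.\<close>
    using sums_finite[of "{0}" "\<lambda>n. (if n + 1 = 1 then 1 else 0) * z ^ (n + 1)"] by simp
  show "(\<lambda>n. (if n + 2 = 2 then 1 / 2 else 0) * z ^ (n + 2)) sums (z\<^sup>2 / 2)"
    using sums_finite[of "{0}" "\<lambda>n. (if n + 2 = 2 then 1 / 2 else 0) * z ^ (n + 2)"]
    by (simp add: power2_eq_square)
qed

theorem theorem1:
  shows "(\<forall>(C::real) f h g a b.
            0 \<le> C \<and> f \<in> harmonic_area_class C \<and> canonical_rep f h g \<and>
            power_series_coeffs h g a b \<longrightarrow>
              norm (a 1) \<le> sqrt (2 * C) \<and>
              (\<forall>n\<ge>2.
                 norm (a n) + norm (b n)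
                   \<le> 4 * Q C r0 / (pi * r0 ^ (n - 1)) * (1 + 1 / real (n - 1)) ^ (n - 1) \<and>
                 4 * Q C r0 / (pi * r0 ^ (n - 1)) * (1 + 1 / real (n - 1)) ^ (n - 1)
                   < 4 * Q C r0 * exp 1 / (pi * r0 ^ (n - 1)))) \<and>
         (let f = (\<lambda>z::complex. z + (cnj z)\<^sup>2 / 2) in
            f \<in> harmonic_area_class (1 / 2) \<and>
            (\<exists>h g a b. canonical_rep f h g \<and> power_series_coeffs h g a b \<and>
               norm (a 1) = sqrt (2 * (1 / 2)) \<and> sqrt (2 * (1 / 2)) = (1::real)))"
proof (intro conjI)
  show "\<forall>(C::real) f h g a b.
            0 \<le> C \<and> f \<in> harmonic_area_class C \<and> canonical_rep f h g \<and>
            power_series_coeffs h g a b \<longrightarrow>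
              norm (a 1) \<le> sqrt (2 * C) \<and>
              (\<forall>n\<ge>2.
                 norm (a n) + norm (b n)
                   \<le> 4 * Q C r0 / (pi * r0 ^ (n - 1)) * (1 + 1 / real (n - 1)) ^ (n - 1) \<and>
                 4 * Q C r0 / (pi * r0 ^ (n - 1)) * (1 + 1 / real (n - 1)) ^ (n - 1)
                   < 4 * Q C r0 * exp 1 / (pi * r0 ^ (n - 1)))"
  proof (intro allI impI, elim conjE, intro conjI allI impI)
    fix C f h g a b
    assume f: "f \<in> harmonic_area_class C" and rep: "canonical_rep f h g"
      and ps: "power_series_coeffs h g a b"
    note coeff = harmonic_area_class_coefficient_bounds[OF f rep ps]
    show "norm (a 1) \<le> sqrt (2 * C)" by (rule coeff(1)) simp
    fix n :: nat assume n: "2 \<le> n"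
    define m where "m = n - 1"
    have m: "1 \<le> m" using n by (simp add: m_def)
    have Q: "sqrt (2 * C) \<le> Q C r0" using coeff(3) by (intro sqrt_le_Q_r0) simp
    have "0 < sqrt (2 * C)" using coeff(3) by simp
    with Q have Q_pos: "0 < Q C r0" by linarith
    have r: "0 < r0 ^ m" "r0 ^ m \<le> 1"
      using r0_bounds by (auto intro!: power_le_one)
    \<comment> \<open>Since \<open>pi < 4\<close> and \<open>r0 ^ m <= 1\<close>, the prefactor on
      the right of the claim is at least \<open>Q C r0\<close>.\<close>
    have "pi * r0 ^ m \<le> 4 * 1"
      using r pi_less_4 by (intro mult_mono) auto
    then have "Q C r0 * (pi * r0 ^ m) \<le> Q C r0 * 4"
      using Q_pos by (intro mult_left_mono) auto
    then have K: "Q C r0 \<le> 4 * Q C r0 / (pi * r0 ^ m)"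
      using r by (subst pos_le_divide_eq) (auto simp: mult_ac)
    \<comment> \<open>Each coefficient is at most \<open>sqrt (2 * C)\<close>, hence at most
      \<open>Q C r0\<close>; the factor 2 is absorbed by \<open>(1 + 1/m)^m >= 2\<close>.\<close>
    have "norm (a n) + norm (b n) \<le> Q C r0 * 2"
      using coeff(1)[of n] coeff(2)[of n] n Q by simp
    also have "\<dots> \<le> 4 * Q C r0 / (pi * r0 ^ m) * (1 + 1 / real m) ^ m"
      using K Q_pos one_plus_inverse_power_bounds(1)[OF m] by (intro mult_mono) auto
    finally show "norm (a n) + norm (b n)
        \<le> 4 * Q C r0 / (pi * r0 ^ (n - 1)) * (1 + 1 / real (n - 1)) ^ (n - 1)"
      by (simp only: m_def)
    \<comment> \<open>Strictness requires a positive prefactor, which comes from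
      \<open>0 < C\<close>.\<close>
    have "4 * Q C r0 / (pi * r0 ^ m) * (1 + 1 / real m) ^ m < 4 * Q C r0 / (pi * r0 ^ m) * exp 1"
      using K Q_pos one_plus_inverse_power_bounds(2)[OF m] by (intro mult_strict_left_mono) auto
    then show "4 * Q C r0 / (pi * r0 ^ (n - 1)) * (1 + 1 / real (n - 1)) ^ (n - 1)
        < 4 * Q C r0 * exp 1 / (pi * r0 ^ (n - 1))"
      by (simp add: m_def)
  qed
  have "(\<lambda>z::complex. z + (cnj z)\<^sup>2 / 2) = extremal_map"
    by (simp add: fun_eq_iff extremal_map_def)
  then show "let f = (\<lambda>z::complex. z + (cnj z)\<^sup>2 / 2) in
            f \<in> harmonic_area_class (1 / 2) \<and>
            (\<exists>h g a b. canonical_rep f h g \<and> power_series_coeffs h g a b \<and>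
               norm (a 1) = sqrt (2 * (1 / 2)) \<and> sqrt (2 * (1 / 2)) = (1::real))"
    unfolding Let_def
    using extremal_map_in_harmonic_area_class canonical_rep_extremal_map power_series_coeffs_extremal_map
    by (simp only:) (intro conjI exI, auto)
qed

end
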